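(* Let $\mathcal{A} := (A, *, [\,,\,,\,])$ be a Bol algebra and $\beta$ an endomorphism of $\mathcal{A}$. Define on $A$ a binary operation $\widetilde{*}$ and a ternary operation $\{\,,\,,\,\}$ by $$x \,\widetilde{*}\, y := \beta(x*y), \qquad \{x,y,z\} := \beta^2([x,y,z])$$ for all $x,y,z\in A$. Then $(A, \widetilde{*}, \{\,,\,,\,\}, \beta)$ is a Hom-Bol algebra.
   Context: All vector spaces are over a fixed ground field of characteristic $0$. Binary and ternary operations are bilinear and trilinear maps respectively. $\circlearrowleft_{x,y,z}$ denotes the sum over cyclic permutations of $x,y,z$. A (left) Bol algebra is a triple $(A, *, [\,,\,,\,])$, with $A$ a vector space, $*$ a bilinear operation and $[\,,\,,\,]$ a trilinear operation on $A$ such that for all $u,v,w,x,y,z\in A$: (B1) $x*y = -y*x$; (B2) $[x,y,z] = -[y,x,z]$; (B3) $\circlearrowleft_{x,y,z}[x,y,z]=0$; (B4) $[x,y,u*v] = [x,y,u]*v + u*[x,y,v] + [u,v,x*y] - (u*v)*(x*y)$; (B5) $[x,y,[u,v,w]] = [[x,y,u],v,w] + [u,[x,y,v],w] + [u,v,[x,y,w]]$. An endomorphism of a Bol algebra is a linear self-map $\beta$ with $\beta(x*y)=\beta(x)*\beta(y)$ and $\beta([x,y,z])=[\beta(x),\beta(y),\beta(z)]$ for all $x,y,z$. A Hom-Bol algebra is a quadruple $(A, *, \{\,,\,,\,\}, \alpha)$ in which $A$ is a vector space, $*$ a binary operation and $\{\,,\,,\,\}$ a ternary operation on $A$, and $\alpha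 : A \to A$ a linear map such that for all $u,v,w,x,y,z \in A$: (HB1) $\alpha(x*y) = \alpha(x)*\alpha(y)$; (HB2) $\alpha(\{x,y,z\}) = \{\alpha(x),\alpha(y),\alpha(z)\}$; (HB3) $x*y = -y*x$; (HB4) $\{x,y,z\} = -\{y,x,z\}$; (HB5) $\circlearrowleft_{x,y,z}\{x,y,z\} = 0$; (HB6) $\{\alpha(x),\alpha(y),u*v\} = \{x,y,u\}*\alpha^2(v) + \alpha^2(u)*\{x,y,v\} + \{\alpha(u),\alpha(v),x*y\} - (\alpha(u)*\alpha(v))*(\alpha(x)*\alpha(y))$; (HB7) $\{\alpha^2(x),\alpha^2(y),\{u,v,w\}\} = \{\{x,y,u\},\alpha^2(v),\alpha^2(w)\} + \{\alpha^2(u),\{x,y,v\},\alpha^2(w)\} + \{\alpha^2(u),\alpha^2(v),\{x,y,w\}\}$. *)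

theory Defs
  imports Complex_Main
begin

text \<open>The underlying vector space is a whole type \<open>'v\<close>, with scalar multiplication \<open>scale\<close> over
  a field of characteristic zero, in the sense of the locale \<^locale>\<open>vector_space\<close>.\<close>

definition bilinear_op ::
  "('k::field_char_0 \<Rightarrow> 'v::ab_group_add \<Rightarrow> 'v) \<Rightarrow> ('v \<Rightarrow> 'v \<Rightarrow> 'v) \<Rightarrow> bool" where
  "bilinear_op scale f \<longleftrightarrow>
    (\<forall>y. Vector_Spaces.linear scale scale (\<lambda>x. f x y)) \<and>
    (\<forall>x. Vector_Spaces.linear scale scale (\<lambda>y. f x y))"

definition trilinear_op ::
  "('k::field_char_0 \<Rightarrow> 'v::ab_group_add \<Rightarrow> 'v) \<Rightarrow> ('v \<Rightarrow> 'v \<Rightarrow> 'v \<Rightarrow> 'v) \<Rightarrow> bool" where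
  "trilinear_op scale t \<longleftrightarrow>
    (\<forall>y z. Vector_Spaces.linear scale scale (\<lambda>x. t x y z)) \<and>
    (\<forall>x z. Vector_Spaces.linear scale scale (\<lambda>y. t x y z)) \<and>
    (\<forall>x y. Vector_Spaces.linear scale scale (\<lambda>z. t x y z))"

locale bol_algebra = vector_space scale
  for scale :: "'k::field_char_0 \<Rightarrow> 'v::ab_group_add \<Rightarrow> 'v" +
  fixes mul :: "'v \<Rightarrow> 'v \<Rightarrow> 'v"  (infixl "\<star>" 70)
    and tri :: "'v \<Rightarrow> 'v \<Rightarrow> 'v \<Rightarrow> 'v"
  assumes bilinear_mul: "bilinear_op scale mul"
    and trilinear_tri: "trilinear_op scale tri"
    and B1: "x \<star> y = - (y \<star> x)"
    and B2: "tri x y z = - tri y x z"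
    and B3: "tri x y z + tri y z x + tri z x y = 0"
    and B4: "tri x y (u \<star> v) =
      tri x y u \<star> v + u \<star> tri x y v + tri u v (x \<star> y) - (u \<star> v) \<star> (x \<star> y)"
    and B5: "tri x y (tri u v w) =
      tri (tri x y u) v w + tri u (tri x y v) w + tri u v (tri x y w)"

definition (in bol_algebra) endomorphism :: "('v \<Rightarrow> 'v) \<Rightarrow> bool" where
  "endomorphism \<beta> \<longleftrightarrow>
    Vector_Spaces.linear scale scale \<beta> \<and>
    (\<forall>x y. \<beta> (x \<star> y) = \<beta> x \<star> \<beta> y) \<and>
    (\<forall>x y z. \<beta> (tri x y z) = tri (\<beta> x) (\<beta> y) (\<beta> z))"

locale hom_bol_algebra = vector_space scale
  for scale :: "'k::field_char_0 \<Rightarrow> 'v::ab_group_add \<Rightarrow> 'v" +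
  fixes mul :: "'v \<Rightarrow> 'v \<Rightarrow> 'v"  (infixl "\<star>" 70)
    and tri :: "'v \<Rightarrow> 'v \<Rightarrow> 'v \<Rightarrow> 'v"
    and \<alpha> :: "'v \<Rightarrow> 'v"
  assumes bilinear_mul: "bilinear_op scale mul"
    and trilinear_tri: "trilinear_op scale tri"
    and linear_twist: "Vector_Spaces.linear scale scale \<alpha>"
    and HB1: "\<alpha> (x \<star> y) = \<alpha> x \<star> \<alpha> y"
    and HB2: "\<alpha> (tri x y z) = tri (\<alpha> x) (\<alpha> y) (\<alpha> z)"
    and HB3: "x \<star> y = - (y \<star> x)"
    and HB4: "tri x y z = - tri y x z"
    and HB5: "tri x y z + tri y z x + tri z x y = 0"
    and HB6: "tri (\<alpha> x) (\<alpha> y) (u \<star> v) =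
      tri x y u \<star> (\<alpha> ^^ 2) v + (\<alpha> ^^ 2) u \<star> tri x y v
      + tri (\<alpha> u) (\<alpha> v) (x \<star> y) - (\<alpha> u \<star> \<alpha> v) \<star> (\<alpha> x \<star> \<alpha> y)"
    and HB7: "tri ((\<alpha> ^^ 2) x) ((\<alpha> ^^ 2) y) (tri u v w) =
      tri (tri x y u) ((\<alpha> ^^ 2) v) ((\<alpha> ^^ 2) w)
      + tri ((\<alpha> ^^ 2) u) (tri x y v) ((\<alpha> ^^ 2) w)
      + tri ((\<alpha> ^^ 2) u) ((\<alpha> ^^ 2) v) (tri x y w)"

end

theory Submission
  imports Defs
begin

text \<open>The result is an instance of the twisting principle for Hom-type algebras: along an
  endomorphism \<open>\<beta>\<close>, an \<open>n\<close>-ary operation is replaced by its composite with \<open>\<beta> ^^ (n - 1)\<close>.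
  This makes each Hom-identity homogeneous in \<open>\<beta>\<close>. As \<open>\<beta>\<close> commutes with both operations, all its
  occurrences can be collected in front of a term, and every term of (HB6) then carries exactly
  \<open>\<beta> ^^ 3\<close>, every term of (HB7) exactly \<open>\<beta> ^^ 4\<close>. For example
  \<open>\<beta> ((\<beta> ^^ 2) (tri x y u) \<star> (\<beta> ^^ 2) v) = (\<beta> ^^ 3) (tri x y u \<star> v)\<close>.
  Hence (HB6) is the image of (B4) under the linear map \<open>\<beta> ^^ 3\<close>, and (HB7) the image of (B5) under
  \<open>\<beta> ^^ 4\<close>. Equivalently, with \<open>\<beta>\<close> pushed inwards instead, they are (B4) and (B5) evaluated at the
  images of the variables under these powers. The skew-symmetries and the cyclic identity are
  preserved by any linear map applied to the values of the operations.\<close>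

lemma bilinear_op_compose_linear:
  assumes "bilinear_op scale f" and "Vector_Spaces.linear scale scale g"
  shows "bilinear_op scale (\<lambda>x y. g (f x y))"
  using assms Vector_Spaces.linear_compose[where g = g, unfolded o_def]
  unfolding bilinear_op_def by blast

lemma trilinear_op_compose_linear:
  assumes "trilinear_op scale t" and "Vector_Spaces.linear scale scale g"
  shows "trilinear_op scale (\<lambda>x y z. g (t x y z))"
  using assms Vector_Spaces.linear_compose[where g = g, unfolded o_def]
  unfolding trilinear_op_def by blast

theorem corollary3p3:
  fixes scale :: "'k::field_char_0 \<Rightarrow> 'v::ab_group_add \<Rightarrow> 'v"
    and mul :: "'v \<Rightarrow> 'v \<Rightarrow> 'v"
    and tri :: "'v \<Rightarrow> 'v \<Rightarrow> 'v \<Rightarrow> 'v"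
    and \<beta> :: "'v \<Rightarrow> 'v"
  assumes "bol_algebra scale mul tri"
    and "bol_algebra.endomorphism scale mul tri \<beta>"
  shows "hom_bol_algebra scale (\<lambda>x y. \<beta> (mul x y)) (\<lambda>x y z. (\<beta> ^^ 2) (tri x y z)) \<beta>"
proof -
  interpret bol_algebra scale mul tri by fact
  have linear: "Vector_Spaces.linear scale scale \<beta>"
    and \<beta>_mul: "\<beta> (mul x y) = mul (\<beta> x) (\<beta> y)"
    and \<beta>_tri: "\<beta> (tri x y z) = tri (\<beta> x) (\<beta> y) (\<beta> z)" for x y z
    using assms(2) unfolding endomorphism_def by blast+
  interpret \<beta>: Vector_Spaces.linear scale scale \<beta> by (fact linear)
  have square: "(\<beta> ^^ 2) x = \<beta> (\<beta> x)" for x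
    by (simp add: numeral_2_eq_2)
  have linear_square: "Vector_Spaces.linear scale scale (\<lambda>x. \<beta> (\<beta> x))"
    using Vector_Spaces.linear_compose[OF linear linear] by (simp add: o_def)
  show ?thesis
    unfolding square
  proof (unfold_locales, unfold square)
    show "bilinear_op scale (\<lambda>x y. \<beta> (mul x y))"
      by (rule bilinear_op_compose_linear[OF bilinear_mul linear])
    show "trilinear_op scale (\<lambda>x y z. \<beta> (\<beta> (tri x y z)))"
      by (rule trilinear_op_compose_linear[OF trilinear_tri linear_square])
    fix u v w x y z
    show "\<beta> (\<beta> (mul x y)) = \<beta> (mul (\<beta> x) (\<beta> y))"
      by (simp add: \<beta>_mul)
    show "\<beta> (\<beta> (\<beta> (tri x y z))) = \<beta> (\<beta> (tri (\<beta> x) (\<beta> y) (\<beta> z)))"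
      by (simp add: \<beta>_tri)
    show "\<beta> (mul x y) = - \<beta> (mul y x)"
      using B1[of x y] by (metis \<beta>.neg)
    show "\<beta> (\<beta> (tri x y z)) = - \<beta> (\<beta> (tri y x z))"
      using B2[of x y z] by (metis \<beta>.neg)
    show "\<beta> (\<beta> (tri x y z)) + \<beta> (\<beta> (tri y z x)) + \<beta> (\<beta> (tri z x y)) = 0"
      unfolding \<beta>_tri by (rule B3)
    show "\<beta> (\<beta> (tri (\<beta> x) (\<beta> y) (\<beta> (mul u v)))) =
        \<beta> (mul (\<beta> (\<beta> (tri x y u))) (\<beta> (\<beta> v))) + \<beta> (mul (\<beta> (\<beta> u)) (\<beta> (\<beta> (tri x y v))))
        + \<beta> (\<beta> (tri (\<beta> u) (\<beta> v) (\<beta> (mul x y))))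
        - \<beta> (mul (\<beta> (mul (\<beta> u) (\<beta> v))) (\<beta> (mul (\<beta> x) (\<beta> y))))"
      unfolding \<beta>_mul \<beta>_tri by (rule B4)
    show "\<beta> (\<beta> (tri (\<beta> (\<beta> x)) (\<beta> (\<beta> y)) (\<beta> (\<beta> (tri u v w))))) =
        \<beta> (\<beta> (tri (\<beta> (\<beta> (tri x y u))) (\<beta> (\<beta> v)) (\<beta> (\<beta> w))))
        + \<beta> (\<beta> (tri (\<beta> (\<beta> u)) (\<beta> (\<beta> (tri x y v))) (\<beta> (\<beta> w))))
        + \<beta> (\<beta> (tri (\<beta> (\<beta> u)) (\<beta> (\<beta> v)) (\<beta> (\<beta> (tri x y w)))))"
      unfolding \<beta>_tri by (rule B5)
  qed
qed

end
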